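(* Let $\sigma>0$ and let $(\psi,\vartheta)$ be a $\sigma$-periodic cocycle in a real separable Hilbert space $\mathbb{H}$. Suppose: (i) $P\colon\mathbb{H}\to\mathbb{H}$ is a bounded self-adjoint linear operator and $\mathbb{H}=\mathbb{H}^{+}\oplus\mathbb{H}^{-}$ is an orthogonal direct sum of $P$-invariant subspaces with $P|_{\mathbb{H}^{-}}<0$ and $P|_{\mathbb{H}^{+}}>0$; (ii) $\dim\mathbb{H}^{-}=1$; (iii) with $V(u):=(Pu,u)$ there are numbers $\delta>0$ and $\nu>0$ such that $$e^{2\nu r}V(\psi^{r}(q,u)-\psi^{r}(q,v))-e^{2\nu l}V(\psi^{l}(q,u)-\psi^{l}(q,v))\le-\delta\int_{l}^{r}e^{2\nu s}|\psi^{s}(q,u)-\psi^{s}(q,v)|^{2}ds$$ for all $u,v\in\mathbb{H}$, $q\in\mathcal{Q}$ and $0\le l\le r$; (iv) every bounded semi-trajectory of the cocycle is compact. Then any isolated Lyapunov stable $\sigma$-periodic trajectory is asymptotically Lyapunov stable.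
   Context: A cocycle $(\psi,\vartheta)$ in $\mathbb{H}$ over a flow $\{\vartheta^t\}_{t\in\mathbb{R}}$ on a metric space $\mathcal{Q}$ is a family of maps $\psi^{t}\colon\mathcal{Q}\times\mathbb{H}\to\mathbb{H}$, $t\ge0$, such that $\psi^{0}(q,u)=u$; $\psi^{t+s}(q,u)=\psi^{t}(\vartheta^{s}(q),\psi^{s}(q,u))$ for all $u,q$ and $t,s\ge0$; and $(t,q,u)\mapsto\psi^{t}(q,u)$ is continuous on $\mathbb{R}_{+}\times\mathcal{Q}\times\mathbb{H}$. It is $\sigma$-periodic if $\mathcal{Q}=\mathbb{R}/\sigma\mathbb{Z}$ and $\vartheta^{t}(\theta)=\theta+t$. $P|_{E}<0$ (resp. $>0$) means $(Pu,u)<0$ (resp. $>0$) for all non-zero $u\in E$. A semi-trajectory is a map $t\mapsto\psi^t(q,u_0)$, $t\ge0$; it is bounded (resp. compact) if its range is bounded (resp. relatively compact). A complete trajectory at $q$ is a continuous map $u\colon\mathbb{R}\to\mathbb{H}$ with $u(t+s)=\psi^{t}(\vartheta^{s}(q),u(s))$ for all $t\ge0$, $s\in\mathbb{R}$; it is a $\sigma$-periodic trajectory if moreover $u(t+\sigma)=u(t)$ for all $t$. A $\sigma$-periodic trajectory $v^{*}$ at $q$ is isolated if some neighbourhood of $v^{*}(0)$ in $\mathbb{H}$ contains $u^{*}(0)$ for no other $\sigma$-periodic trajectory $u^{*}$ at $q$. A trajectory $v^{*}$ at $q$ is Lyapunov stable if for every $\varepsilon>0$ there is $\eta>0$ such that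 any $u(t)=\psi^{t}(q,u_0)$ with $|u(0)-v^{*}(0)|<\eta$ satisfies $|u(t)-v^{*}(t)|<\varepsilon$ for all $t\ge0$; it is asymptotically Lyapunov stable if it is Lyapunov stable and there is $\eta_0>0$ such that $|u(0)-v^{*}(0)|<\eta_0$ implies $u(t)-v^{*}(t)\to0$ as $t\to+\infty$. *)

theory Defs
  imports "HOL-Analysis.Analysis" "HOL-Library.Real_Mod"
begin

definition flow_on :: "'q set \<Rightarrow> ('q \<Rightarrow> 'q \<Rightarrow> real) \<Rightarrow> (real \<Rightarrow> 'q \<Rightarrow> 'q) \<Rightarrow> bool" where
  "flow_on Q d \<theta> \<longleftrightarrow>
     Metric_space Q d \<and>
     (\<forall>q\<in>Q. \<theta> 0 q = q) \<and>
     (\<forall>q\<in>Q. \<forall>t s. \<theta> (t + s) q = \<theta> t (\<theta> s q)) \<and>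
     continuous_map (prod_topology euclideanreal (Metric_space.mtopology Q d))
       (Metric_space.mtopology Q d) (\<lambda>(t, q). \<theta> t q)"

definition cocycle_over ::
  "'q set \<Rightarrow> ('q \<Rightarrow> 'q \<Rightarrow> real) \<Rightarrow> (real \<Rightarrow> 'q \<Rightarrow> 'q) \<Rightarrow>
   (real \<Rightarrow> 'q \<Rightarrow> 'h \<Rightarrow> 'h::real_normed_vector) \<Rightarrow> bool" where
  "cocycle_over Q d \<theta> \<psi> \<longleftrightarrow>
     flow_on Q d \<theta> \<and>
     (\<forall>q\<in>Q. \<forall>u. \<psi> 0 q u = u) \<and>
     (\<forall>q\<in>Q. \<forall>u. \<forall>t\<ge>0. \<forall>s\<ge>0. \<psi> (t + s) q u = \<psi> t (\<theta> s q) (\<psi> s q u)) \<and>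
     continuous_map
       (prod_topology (top_of_set {0..})
         (prod_topology (Metric_space.mtopology Q d) euclidean))
       euclidean (\<lambda>(t, q, u). \<psi> t q u)"

text \<open>Points of \<open>circle \<sigma>\<close> are residue classes modulo \<open>\<sigma>\<close>, as sets of reals.  The metric
  is the quotient metric, that is, the minimal distance of representatives.\<close>

definition circle :: "real \<Rightarrow> real set set" where
  "circle \<sigma> = UNIV // {(x, y). [x = y] (rmod \<sigma>)}"

definition circle_dist :: "real set \<Rightarrow> real set \<Rightarrow> real" where
  "circle_dist A B = setdist A B"

definition rotation :: "real \<Rightarrow> real set \<Rightarrow> real set" where
  "rotation t A = (\<lambda>x. x + t) ` A"

definition periodic_cocycle ::
  "real \<Rightarrow> (real \<Rightarrow> real set \<Rightarrow> 'h \<Rightarrow> 'h::real_normed_vector) \<Rightarrow> bool" where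
  "periodic_cocycle \<sigma> \<psi> \<longleftrightarrow> cocycle_over (circle \<sigma>) circle_dist rotation \<psi>"

text \<open>The rotation is a flow on the metric space \<open>circle \<sigma>\<close>, so the corresponding conjuncts of
  \<^const>\<open>periodic_cocycle\<close> do not restrict anything.\<close>

lemma circle_iff:
  "A \<in> circle \<sigma> \<longleftrightarrow> (\<exists>x. A = range (\<lambda>k::int. x + of_int k * \<sigma>))"
proof -
  have "{y. [x = y] (rmod \<sigma>)} = range (\<lambda>k::int. x + of_int k * \<sigma>)" for x
    by (auto simp: rcong_altdef)
  then show ?thesis
    by (auto simp: circle_def quotient_def Image_def)
qed

lemma circle_nonempty: "A \<in> circle \<sigma> \<Longrightarrow> A \<noteq> {}"
  by (auto simp: circle_iff)

lemma circle_shift: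
  assumes "A \<in> circle \<sigma>" "B \<in> circle \<sigma>" "a \<in> A" "a' \<in> A" "b \<in> B"
  shows "b + (a' - a) \<in> B"
proof -
  obtain x y where AB: "A = range (\<lambda>k::int. x + of_int k * \<sigma>)" "B = range (\<lambda>k::int. y + of_int k * \<sigma>)"
    using assms(1,2) by (auto simp: circle_iff)
  obtain i j k :: int where "a = x + of_int i * \<sigma>" "a' = x + of_int j * \<sigma>" "b = y + of_int k * \<sigma>"
    using assms(3-5) AB by auto
  then have "b + (a' - a) = y + of_int (k + j - i) * \<sigma>"
    by (simp add: algebra_simps)
  then show ?thesis
    using AB by blast
qed

lemma circle_eqI:
  assumes "A \<in> circle \<sigma>" "B \<in> circle \<sigma>" "a \<in> A" "a \<in> B"
  shows "A = B"
proof
  show "A \<subseteq> B"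
    using circle_shift[OF assms(1,2,3) _ assms(4)] by auto
  show "B \<subseteq> A"
    using circle_shift[OF assms(2,1,4) _ assms(3)] by auto
qed

lemma circle_closed:
  assumes "A \<in> circle \<sigma>"
  shows "closed A"
proof -
  obtain x where A: "A = range (\<lambda>k::int. x + of_int k * \<sigma>)"
    using assms by (auto simp: circle_iff)
  have "A = (+) x ` ((\<lambda>y. \<sigma> *\<^sub>R y) ` \<int>)"
    by (auto simp: A Ints_def image_iff mult.commute)
  then show ?thesis
    by (metis closed_Ints closed_scaling closed_translation)
qed

lemma circle_dist_attained:
  assumes "A \<in> circle \<sigma>" "B \<in> circle \<sigma>" "a \<in> A"
  obtains b where "b \<in> B" "circle_dist A B = \<bar>a - b\<bar>"
proof -
  have "setdist {a} B \<le> setdist A B"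
  proof (rule le_setdistI)
    fix x y assume "x \<in> A" "y \<in> B"
    then have "y + (a - x) \<in> B"
      using circle_shift[OF assms(1,2)] assms(3) by blast
    then have "setdist {a} B \<le> dist a (y + (a - x))"
      by (intro setdist_le_dist) auto
    then show "setdist {a} B \<le> dist x y"
      by (simp add: dist_real_def)
  qed (use assms circle_nonempty in auto)
  moreover have "setdist A B \<le> setdist {a} B"
    using assms by (intro setdist_subset_left) auto
  moreover obtain b where "b \<in> B" "setdist {a} B = dist a b"
    using setdist_closed_compact[of B "{a}"] setdist_compact_closed[of "{a}" B]
      circle_closed circle_nonempty assms(2) by force
  ultimately show thesis
    using that by (auto simp: circle_dist_def dist_real_def)
qed

lemma circle_dist_le: "a \<in> A \<Longrightarrow> b \<in> B \<Longrightarrow> circle_dist A B \<le> \<bar>a - b\<bar>"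
  unfolding circle_dist_def by (metis setdist_le_dist dist_real_def)

lemma Metric_space_circle: "Metric_space (circle \<sigma>) circle_dist"
proof
  show "0 \<le> circle_dist A B" for A B
    by (simp add: circle_dist_def)
  show "circle_dist A B = circle_dist B A" for A B
    by (simp add: circle_dist_def setdist_sym)
next
  fix A B assume AB: "A \<in> circle \<sigma>" "B \<in> circle \<sigma>"
  obtain a where a: "a \<in> A"
    using AB circle_nonempty by blast
  show "(circle_dist A B = 0) = (A = B)"
  proof
    assume 0: "circle_dist A B = 0"
    obtain b where "b \<in> B" "circle_dist A B = \<bar>a - b\<bar>"
      by (rule circle_dist_attained[OF AB a])
    with 0 a show "A = B"
      using circle_eqI[OF AB] by auto
  qed (simp add: circle_dist_def setdist_refl)
next
  fix A B C assume ABC: "A \<in> circle \<sigma>" "B \<in> circle \<sigma>" "C \<in> circle \<sigma>"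
  obtain a where a: "a \<in> A"
    using ABC circle_nonempty by blast
  obtain b where b: "b \<in> B" "circle_dist A B = \<bar>a - b\<bar>"
    by (rule circle_dist_attained[OF ABC(1,2) a])
  obtain c where c: "c \<in> C" "circle_dist B C = \<bar>b - c\<bar>"
    by (rule circle_dist_attained[OF ABC(2,3) b(1)])
  show "circle_dist A C \<le> circle_dist A B + circle_dist B C"
    using circle_dist_le[OF a c(1)] b c by linarith
qed

lemma rotation_in_circle: "A \<in> circle \<sigma> \<Longrightarrow> rotation t A \<in> circle \<sigma>"
proof -
  assume "A \<in> circle \<sigma>"
  then obtain x where A: "A = range (\<lambda>k::int. x + of_int k * \<sigma>)"
    by (auto simp: circle_iff)
  have "rotation t A = range (\<lambda>k::int. (x + t) + of_int k * \<sigma>)"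
    by (simp add: A rotation_def image_image algebra_simps)
  then show ?thesis
    by (auto simp: circle_iff)
qed

lemma circle_dist_rotation_le:
  assumes "A \<in> circle \<sigma>" "B \<in> circle \<sigma>"
  shows "circle_dist (rotation t A) (rotation s B) \<le> \<bar>t - s\<bar> + circle_dist A B"
proof -
  obtain a where a: "a \<in> A"
    using assms circle_nonempty by blast
  obtain b where b: "b \<in> B" "circle_dist A B = \<bar>a - b\<bar>"
    by (rule circle_dist_attained[OF assms a])
  have "circle_dist (rotation t A) (rotation s B) \<le> \<bar>(a + t) - (b + s)\<bar>"
    using a b by (intro circle_dist_le) (auto simp: rotation_def)
  then show ?thesis
    using b by linarith
qed

lemma flow_on_rotation: "flow_on (circle \<sigma>) circle_dist rotation"
proof -
  interpret M: Metric_space "circle \<sigma>" circle_dist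
    by (rule Metric_space_circle)
  have "continuous_map (prod_topology euclideanreal M.mtopology) M.mtopology (\<lambda>(t, A). rotation t A)"
    unfolding M.continuous_map_to_metric
  proof (intro ballI allI impI)
    fix z \<epsilon> assume z: "z \<in> topspace (prod_topology euclideanreal M.mtopology)" and e: "\<epsilon> > (0::real)"
    obtain t A where zt: "z = (t, A)" "A \<in> circle \<sigma>"
      using z by auto
    let ?U = "ball t (\<epsilon>/2) \<times> M.mball A (\<epsilon>/2)"
    have "openin (prod_topology euclideanreal M.mtopology) ?U"
      by (simp add: openin_prod_Times_iff M.openin_mball)
    moreover have "z \<in> ?U"
      using zt e by simp
    moreover have "(case y of (s, B) \<Rightarrow> rotation s B) \<in> M.mball (case z of (t, A) \<Rightarrow> rotation t A) \<epsilon>"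
      if y: "y \<in> ?U" for y
    proof -
      obtain s B where sB: "y = (s, B)" by (cases y)
      with y have "B \<in> circle \<sigma>" "\<bar>t - s\<bar> < \<epsilon>/2" "circle_dist A B < \<epsilon>/2"
        by (auto simp: dist_real_def)
      then show ?thesis
        using circle_dist_rotation_le[of A \<sigma> B t s] zt sB rotation_in_circle by auto
    qed
    ultimately show "\<exists>U. openin (prod_topology euclideanreal M.mtopology) U \<and> z \<in> U \<and>
        (\<forall>y\<in>U. (case y of (s, B) \<Rightarrow> rotation s B) \<in> M.mball (case z of (t, A) \<Rightarrow> rotation t A) \<epsilon>)"
      by blast
  qed
  then show ?thesis
    by (auto simp: flow_on_def Metric_space_circle rotation_def image_image algebra_simps)
qed

definition quad_form :: "('h \<Rightarrow> 'h) \<Rightarrow> 'h::real_inner \<Rightarrow> real" where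
  "quad_form P u = P u \<bullet> u"

definition neg_definite_on :: "('h \<Rightarrow> 'h) \<Rightarrow> 'h::real_inner set \<Rightarrow> bool" where
  "neg_definite_on P E \<longleftrightarrow> (\<forall>u\<in>E. u \<noteq> 0 \<longrightarrow> P u \<bullet> u < 0)"

definition pos_definite_on :: "('h \<Rightarrow> 'h) \<Rightarrow> 'h::real_inner set \<Rightarrow> bool" where
  "pos_definite_on P E \<longleftrightarrow> (\<forall>u\<in>E. u \<noteq> 0 \<longrightarrow> P u \<bullet> u > 0)"

text \<open>Closedness of the summands need not be required: each is the orthogonal complement of
  the other.\<close>

definition orthogonal_direct_sum :: "'h::real_inner set \<Rightarrow> 'h set \<Rightarrow> bool" where
  "orthogonal_direct_sum E F \<longleftrightarrow>
     subspace E \<and> subspace F \<and> (\<forall>x\<in>E. \<forall>y\<in>F. orthogonal x y) \<and>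
     (\<forall>z. \<exists>x\<in>E. \<exists>y\<in>F. z = x + y)"

definition bounded_semi_trajectory ::
  "(real \<Rightarrow> 'q \<Rightarrow> 'h \<Rightarrow> 'h::real_normed_vector) \<Rightarrow> 'q \<Rightarrow> 'h \<Rightarrow> bool" where
  "bounded_semi_trajectory \<psi> q u\<^sub>0 \<longleftrightarrow> bounded ((\<lambda>t. \<psi> t q u\<^sub>0) ` {0..})"

definition compact_semi_trajectory ::
  "(real \<Rightarrow> 'q \<Rightarrow> 'h \<Rightarrow> 'h::real_normed_vector) \<Rightarrow> 'q \<Rightarrow> 'h \<Rightarrow> bool" where
  "compact_semi_trajectory \<psi> q u\<^sub>0 \<longleftrightarrow> compact (closure ((\<lambda>t. \<psi> t q u\<^sub>0) ` {0..}))"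

definition complete_trajectory ::
  "(real \<Rightarrow> 'q \<Rightarrow> 'q) \<Rightarrow> (real \<Rightarrow> 'q \<Rightarrow> 'h \<Rightarrow> 'h::real_normed_vector) \<Rightarrow> 'q \<Rightarrow> (real \<Rightarrow> 'h) \<Rightarrow> bool" where
  "complete_trajectory \<theta> \<psi> q u \<longleftrightarrow>
     continuous_on UNIV u \<and> (\<forall>t\<ge>0. \<forall>s. u (t + s) = \<psi> t (\<theta> s q) (u s))"

definition periodic_trajectory ::
  "real \<Rightarrow> (real \<Rightarrow> 'q \<Rightarrow> 'q) \<Rightarrow> (real \<Rightarrow> 'q \<Rightarrow> 'h \<Rightarrow> 'h::real_normed_vector) \<Rightarrow> 'q \<Rightarrow> (real \<Rightarrow> 'h) \<Rightarrow> bool" where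
  "periodic_trajectory \<sigma> \<theta> \<psi> q u \<longleftrightarrow>
     complete_trajectory \<theta> \<psi> q u \<and> (\<forall>t. u (t + \<sigma>) = u t)"

definition isolated_periodic_trajectory ::
  "real \<Rightarrow> (real \<Rightarrow> 'q \<Rightarrow> 'q) \<Rightarrow> (real \<Rightarrow> 'q \<Rightarrow> 'h \<Rightarrow> 'h::real_normed_vector) \<Rightarrow> 'q \<Rightarrow> (real \<Rightarrow> 'h) \<Rightarrow> bool" where
  "isolated_periodic_trajectory \<sigma> \<theta> \<psi> q v \<longleftrightarrow>
     periodic_trajectory \<sigma> \<theta> \<psi> q v \<and>
     (\<exists>U. open U \<and> v 0 \<in> U \<and>
       (\<forall>u. periodic_trajectory \<sigma> \<theta> \<psi> q u \<and> u \<noteq> v \<longrightarrow> u 0 \<notin> U))"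

definition lyapunov_stable ::
  "(real \<Rightarrow> 'q \<Rightarrow> 'h \<Rightarrow> 'h::real_normed_vector) \<Rightarrow> 'q \<Rightarrow> (real \<Rightarrow> 'h) \<Rightarrow> bool" where
  "lyapunov_stable \<psi> q v \<longleftrightarrow>
     (\<forall>\<epsilon>>0. \<exists>\<eta>>0. \<forall>u\<^sub>0. norm (\<psi> 0 q u\<^sub>0 - v 0) < \<eta> \<longrightarrow> (\<forall>t\<ge>0. norm (\<psi> t q u\<^sub>0 - v t) < \<epsilon>))"

definition asymptotically_lyapunov_stable ::
  "(real \<Rightarrow> 'q \<Rightarrow> 'h \<Rightarrow> 'h::real_normed_vector) \<Rightarrow> 'q \<Rightarrow> (real \<Rightarrow> 'h) \<Rightarrow> bool" where
  "asymptotically_lyapunov_stable \<psi> q v \<longleftrightarrow>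
     lyapunov_stable \<psi> q v \<and>
     (\<exists>\<eta>\<^sub>0>0. \<forall>u\<^sub>0. norm (\<psi> 0 q u\<^sub>0 - v 0) < \<eta>\<^sub>0 \<longrightarrow> ((\<lambda>t. \<psi> t q u\<^sub>0 - v t) \<longlongrightarrow> 0) at_top)"

end

theory Submission
  imports Defs
begin

text \<open>Let \<open>T\<close> be the period map at \<open>q\<close>; its fixed points are the initial values of the periodic
  trajectories.  By squeezing, \<open>V (T x - T y) \<le> e\<^bsup>-2\<nu>\<sigma>\<^esup> V (x - y)\<close>, and \<open>V\<close> cannot vanish on both
  differences unless \<open>x = y\<close>.  Hence, if \<open>V\<close> is nonnegative on all increments of an orbit of \<open>T\<close>,
  these values tend to \<open>0\<close> and every limit point of the orbit is fixed.  Otherwise some increment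
  lies in the cone \<open>V < 0\<close>, and so do all later ones; a path in this cone never crosses \<open>\<bbbH>\<^sup>+\<close>, so the
  coordinate along the line \<open>\<bbbH>\<^sup>-\<close> is eventually monotone on the orbit.  This coordinate is then
  constant on the orbit of any limit point \<open>y\<close>, whose increments lie in \<open>\<bbbH>\<^sup>+\<close>, and the first case
  applies to \<open>y\<close>.  So the closure of each relatively compact orbit contains a fixed point.  Near
  the given trajectory this point can only be \<open>v 0\<close> by isolation, so the orbit comes arbitrarily
  close to \<open>v 0\<close>, and Lyapunov stability yields convergence.\<close>

section \<open>Discrete dynamics: fixed points in the closure of a relatively compact orbit\<close>

lemma limit_point_fixed:
  fixes T :: "'a::real_normed_vector \<Rightarrow> 'a" and V :: "'a \<Rightarrow> real"
  assumes contT: "continuous_on UNIV T" and contV: "continuous_on UNIV V"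
    and decay: "\<And>x y. V (T x - T y) \<le> c * V (x - y)" and c: "0 < c" "c < 1"
    and strict: "\<And>x y. V (x - y) = 0 \<Longrightarrow> V (T x - T y) = 0 \<Longrightarrow> x = y"
    and nonneg: "\<And>n. V ((T ^^ Suc n) x - (T ^^ n) x) \<ge> 0"
    and r: "strict_mono r" and lim: "(\<lambda>n. (T ^^ r n) x) \<longlonglongrightarrow> y"
  shows "T y = y"
proof -
  define w where "w n = V ((T ^^ Suc n) x - (T ^^ n) x)" for n
  have bound: "w n \<le> c ^ n * w 0" for n
  proof (induction n)
    case (Suc n)
    have "w (Suc n) \<le> c * w n"
      using decay by (simp add: w_def)
    also have "\<dots> \<le> c * (c ^ n * w 0)"
      using Suc c by (intro mult_left_mono) auto
    finally show ?case by (simp add: mult_ac)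
  qed simp
  have "w \<longlonglongrightarrow> 0"
  proof (rule tendsto_sandwich[OF _ _ tendsto_const])
    show "(\<lambda>n. c ^ n * w 0) \<longlonglongrightarrow> 0"
      using c by (intro tendsto_mult_left_zero LIMSEQ_realpow_zero) auto
  qed (use nonneg bound in \<open>auto simp: w_def\<close>)
  \<comment> \<open>Two consecutive values are followed along the subsequence, because
    \<open>strict\<close> needs \<open>V\<close> to vanish both before and after an application of
    \<open>T\<close>; it is finally used for the pair \<open>T y\<close>, \<open>y\<close>.\<close>
  then have w0: "(\<lambda>n. w (r n)) \<longlonglongrightarrow> 0" and w1: "(\<lambda>n. w (Suc (r n))) \<longlonglongrightarrow> 0"
    using LIMSEQ_subseq_LIMSEQ[OF _ r, of w 0] LIMSEQ_subseq_LIMSEQ[OF LIMSEQ_Suc r, of w 0]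
    by (auto simp: o_def)
  have T: "(\<lambda>n. T (f n)) \<longlonglongrightarrow> T l" if "f \<longlonglongrightarrow> l" for f :: "nat \<Rightarrow> 'a" and l
    using continuous_on_tendsto_compose[OF contT that] by simp
  have V: "(\<lambda>n. V (f n)) \<longlonglongrightarrow> V l" if "f \<longlonglongrightarrow> l" for f :: "nat \<Rightarrow> 'a" and l
    using continuous_on_tendsto_compose[OF contV that] by simp
  have "(\<lambda>n. w (r n)) \<longlonglongrightarrow> V (T y - y)"
    unfolding w_def funpow.simps o_def by (intro V tendsto_diff T lim)
  moreover have "(\<lambda>n. w (Suc (r n))) \<longlonglongrightarrow> V (T (T y) - T y)"
    unfolding w_def funpow.simps o_def by (intro V tendsto_diff T lim)
  ultimately show ?thesis
    using w0 w1 strict LIMSEQ_unique by blast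
qed

text \<open>A positive product of consecutive increments fixes their common sign from
  \<open>N\<close> on, so the tail is monotone as well as bounded.\<close>

lemma eventually_constant_sign_increments_tendsto:
  fixes a :: "nat \<Rightarrow> real"
  assumes bdd: "bounded (range a)"
    and sign: "\<And>n. n \<ge> N \<Longrightarrow> (a (Suc (Suc n)) - a (Suc n)) * (a (Suc n) - a n) > 0"
  obtains l where "a \<longlonglongrightarrow> l"
proof -
  define b where "b n = a (n + N)" for n
  have b: "(b (Suc (Suc n)) - b (Suc n)) * (b (Suc n) - b n) > 0" for n
    using sign[of "n + N"] by (simp add: b_def)
  have "monoseq b"
  proof (cases "b (Suc 0) - b 0 > 0")
    case True
    have "b (Suc n) - b n > 0" for n
    proof (induction n)
      case (Suc n)
      then show ?case using b[of n] by (simp add: zero_less_mult_iff)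
    qed (use True in simp)
    then show ?thesis
      by (intro mono_SucI1) (simp add: less_imp_le)
  next
    case False
    have "b (Suc n) - b n < 0" for n
    proof (induction n)
      \<comment> \<open>The first increment is a factor of a positive product, hence nonzero; not
        being positive, it is negative.\<close>
      case 0
      then show ?case using b[of 0] False by (simp add: zero_less_mult_iff)
    next
      case (Suc n)
      then show ?case using b[of n] by (simp add: zero_less_mult_iff)
    qed
    then show ?thesis
      by (intro mono_SucI2) (simp add: less_imp_le)
  qed
  moreover have "Bseq b"
    using bdd by (auto simp: Bseq_eq_bounded b_def intro: bounded_subset)
  ultimately obtain l where "b \<longlonglongrightarrow> l"
    using Bseq_monoseq_convergent convergent_def by blast
  then show thesis
    using that LIMSEQ_offset unfolding b_def by blast
qed

text \<open>Here \<open>\<phi>\<close> plays the coordinate along the negative line, and what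
  happens during a period enters only through \<open>sign\<close>.\<close>

lemma fixed_point_in_orbit_closure:
  fixes T :: "'a::real_normed_vector \<Rightarrow> 'a" and V \<phi> :: "'a \<Rightarrow> real"
  assumes contT: "continuous_on UNIV T" and contV: "continuous_on UNIV V"
    and decay: "\<And>x y. V (T x - T y) \<le> c * V (x - y)" and c: "0 < c" "c < 1"
    and strict: "\<And>x y. V (x - y) = 0 \<Longrightarrow> V (T x - T y) = 0 \<Longrightarrow> x = y"
    and phi: "bounded_linear \<phi>" and phi0: "\<And>w. \<phi> w = 0 \<Longrightarrow> V w \<ge> 0"
    and sign: "\<And>x y. V (x - y) < 0 \<Longrightarrow> \<phi> (T x - T y) * \<phi> (x - y) > 0"
    and comp: "compact (closure (range (\<lambda>n. (T ^^ n) x)))"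
  obtains z where "z \<in> closure (range (\<lambda>n. (T ^^ n) x))" "T z = z"
proof -
  let ?K = "closure (range (\<lambda>n. (T ^^ n) x))"
  have in_K: "(T ^^ n) x \<in> ?K" for n
    using closure_subset by fastforce
  \<comment> \<open>The starting point is left free: this serves for \<open>x\<close> itself, and
    otherwise for a limit point of its orbit.\<close>
  have fixed: "\<exists>z\<in>?K. T z = z"
    if K: "\<And>n. (T ^^ n) y \<in> ?K" and "\<And>n. V ((T ^^ Suc n) y - (T ^^ n) y) \<ge> 0" for y
  proof -
    obtain z r where z: "z \<in> ?K" "strict_mono r" "((\<lambda>n. (T ^^ n) y) \<circ> r) \<longlonglongrightarrow> z"
      by (rule seq_compactE[OF compact_imp_seq_compact[OF comp], of "\<lambda>n. (T ^^ n) y"]) (use K in auto)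
    have "T z = z"
      by (rule limit_point_fixed[OF contT contV decay c strict that(2) z(2) z(3)[unfolded o_def]])
    with z(1) show ?thesis by blast
  qed
  show thesis
  proof (cases "\<forall>n. V ((T ^^ Suc n) x - (T ^^ n) x) \<ge> 0")
    case True
    then show ?thesis using fixed[OF in_K] that by blast
  next
    case False
    then obtain N where N: "V ((T ^^ Suc N) x - (T ^^ N) x) < 0"
      by (auto simp: not_le)
    \<comment> \<open>Since \<open>c > 0\<close>, \<open>decay\<close> keeps a negative value
      negative, so \<open>sign\<close> applies to every increment from \<open>N\<close> on.\<close>
    have neg: "V ((T ^^ Suc n) x - (T ^^ n) x) < 0" if "n \<ge> N" for n
      using that
    proof (induction n rule: dec_induct)
      case (step n)
      have le: "V ((T ^^ Suc (Suc n)) x - (T ^^ Suc n) x) \<le> c * V ((T ^^ Suc n) x - (T ^^ n) x)"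
        using decay by simp
      then show ?case
        using step.IH c by (smt (verit) mult_pos_neg)
    qed (rule N)
    interpret phi: bounded_linear \<phi> by (rule phi)
    have "bounded (range (\<lambda>n. (T ^^ n) x))"
      using comp compact_imp_bounded bounded_subset closure_subset by blast
    from bounded_linear_image[OF this phi]
    have "bounded (range (\<lambda>n. \<phi> ((T ^^ n) x)))"
      by (simp add: image_image)
    moreover have "(\<phi> ((T ^^ Suc (Suc n)) x) - \<phi> ((T ^^ Suc n) x)) *
        (\<phi> ((T ^^ Suc n) x) - \<phi> ((T ^^ n) x)) > 0" if "n \<ge> N" for n
      using sign[OF neg[OF that]] by (simp add: phi.diff)
    ultimately obtain l where l: "(\<lambda>n. \<phi> ((T ^^ n) x)) \<longlonglongrightarrow> l"
      by (rule eventually_constant_sign_increments_tendsto)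
    obtain y r where y: "y \<in> ?K" "strict_mono r" "(\<lambda>n. (T ^^ r n) x) \<longlonglongrightarrow> y"
      by (rule seq_compactE[OF compact_imp_seq_compact[OF comp], of "\<lambda>n. (T ^^ n) x"])
        (use in_K in \<open>auto simp: o_def\<close>)
    \<comment> \<open>Every iterate of \<open>y\<close> is again a limit point of the orbit of
      \<open>x\<close>, so it stays in \<open>?K\<close> and has the same
      \<open>\<phi>\<close>-value \<open>l\<close>.\<close>
    have lim: "(\<lambda>n. (T ^^ (k + r n)) x) \<longlonglongrightarrow> (T ^^ k) y" for k
    proof (induction k)
      case (Suc k)
      then show ?case
        using continuous_on_tendsto_compose[OF contT Suc] by simp
    qed (use y in simp)
    have "(T ^^ k) y \<in> ?K" for k
      using closed_sequentially[OF closed_closure _ lim] in_K by blast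
    moreover have "\<phi> ((T ^^ k) y) = l" for k
    proof -
      have "(\<lambda>n. \<phi> ((T ^^ (k + r n)) x)) \<longlonglongrightarrow> \<phi> ((T ^^ k) y)"
        by (rule phi.tendsto[OF lim])
      moreover have "strict_mono (\<lambda>n. k + r n)"
        using y(2) by (simp add: strict_mono_def)
      ultimately show ?thesis
        using LIMSEQ_subseq_LIMSEQ[OF l] LIMSEQ_unique unfolding o_def by blast
    qed
    \<comment> \<open>The increments of the orbit of \<open>y\<close> lie in the kernel of
      \<open>\<phi>\<close>, where \<open>phi0\<close> applies.\<close>
    then have "V ((T ^^ Suc k) y - (T ^^ k) y) \<ge> 0" for k
      by (metis phi0 phi.diff diff_self)
    ultimately show ?thesis
      using fixed that by blast
  qed
qed

section \<open>The period map and periodic trajectories\<close>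

lemma rotation_add: "rotation t (rotation s A) = rotation (t + s) A"
  by (auto simp: rotation_def image_image algebra_simps)

lemma rotation_period:
  assumes "A \<in> circle \<sigma>"
  shows "rotation (of_nat n * \<sigma>) A = A"
proof -
  obtain x where A: "A = range (\<lambda>k::int. x + of_int k * \<sigma>)"
    using assms by (auto simp: circle_iff)
  \<comment> \<open>A common representative: it has index \<open>n\<close> in \<open>A\<close> and
    is the translate of the representative with index 0.\<close>
  have "x + of_int (0 + int n) * \<sigma> \<in> A"
    unfolding A by blast
  moreover have "x + of_int (0 + int n) * \<sigma> \<in> rotation (of_nat n * \<sigma>) A"
    unfolding A rotation_def by (auto intro!: image_eqI[of _ _ 0] image_eqI[of _ _ x])
  ultimately show ?thesis
    using circle_eqI rotation_in_circle assms by blast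
qed

lemma
  assumes "cocycle_over Q d \<theta> \<psi>" "q \<in> Q"
  shows cocycle_continuous_on_time: "continuous_on {0..} (\<lambda>t. \<psi> t q u)"
    and cocycle_continuous_on_space: "t \<ge> 0 \<Longrightarrow> continuous_on UNIV (\<psi> t q)"
proof -
  interpret Metric_space Q d
    using assms by (simp add: cocycle_over_def flow_on_def)
  have c: "continuous_map (prod_topology (top_of_set {0..}) (prod_topology mtopology euclidean))
      euclidean (\<lambda>(t, q, u). \<psi> t q u)"
    using assms by (simp add: cocycle_over_def)
  have "continuous_map (top_of_set {0..})
      (prod_topology (top_of_set {0..}) (prod_topology mtopology euclidean)) (\<lambda>t. (t, q, u))"
    using assms(2) by (intro continuous_map_pairedI) auto
  from continuous_map_compose[OF this c] show "continuous_on {0..} (\<lambda>t. \<psi> t q u)"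
    by (simp add: o_def)
  assume "t \<ge> 0"
  then have "continuous_map euclidean
      (prod_topology (top_of_set {0..}) (prod_topology mtopology euclidean)) (\<lambda>u. (t, q, u))"
    using assms(2) by (intro continuous_map_pairedI) auto
  from continuous_map_compose[OF this c] show "continuous_on UNIV (\<psi> t q)"
    by (simp add: o_def)
qed

text \<open>Whole periods fix the base point \<open>q\<close>, so the cocycle law at these times is
  iteration of a single map.\<close>

lemma periodic_cocycle_iterate:
  assumes "periodic_cocycle \<sigma> \<psi>" "\<sigma> > 0" "q \<in> circle \<sigma>"
  shows "\<psi> (of_nat n * \<sigma>) q u = (\<psi> \<sigma> q ^^ n) u"
proof (induction n)
  case 0
  then show ?case
    using assms by (simp add: periodic_cocycle_def cocycle_over_def)
next
  case (Suc n)
  have "\<psi> (\<sigma> + of_nat n * \<sigma>) q u = \<psi> \<sigma> (rotation (of_nat n * \<sigma>) q) (\<psi> (of_nat n * \<sigma>) q u)"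
    using assms by (simp add: periodic_cocycle_def cocycle_over_def)
  then show ?case
    using Suc assms by (simp add: rotation_period distrib_right)
qed

lemma periodic_cocycle_shift:
  assumes "periodic_cocycle \<sigma> \<psi>" "\<sigma> > 0" "q \<in> circle \<sigma>" "t \<ge> 0"
  shows "\<psi> (t + of_nat n * \<sigma>) q u = \<psi> t q ((\<psi> \<sigma> q ^^ n) u)"
proof -
  have "\<psi> (t + of_nat n * \<sigma>) q u = \<psi> t (rotation (of_nat n * \<sigma>) q) (\<psi> (of_nat n * \<sigma>) q u)"
    using assms by (simp add: periodic_cocycle_def cocycle_over_def)
  then show ?thesis
    using assms by (simp add: rotation_period periodic_cocycle_iterate)
qed

text \<open>The semi-trajectory of a fixed point repeats after each period; it extends to negative
  times by reading the value at \<open>t\<close> after enough added periods.\<close>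

lemma fixed_point_periodic_trajectory:
  assumes cocycle: "periodic_cocycle \<sigma> \<psi>" and sigma: "\<sigma> > 0" and q: "q \<in> circle \<sigma>"
    and fixed: "\<psi> \<sigma> q z = z"
  obtains u where "periodic_trajectory \<sigma> rotation \<psi> q u" "u 0 = z"
proof -
  have co: "cocycle_over (circle \<sigma>) circle_dist rotation \<psi>"
    using cocycle by (simp add: periodic_cocycle_def)
  \<comment> \<open>\<open>m t\<close> periods suffice to make the time nonnegative; by
    \<open>u\<close> below, any other admissible number gives the same value.\<close>
  define m where "m t = nat \<lceil>\<bar>t\<bar> / \<sigma>\<rceil>" for t
  have m: "\<bar>t\<bar> \<le> of_nat (m t) * \<sigma>" for t
  proof -
    have "\<bar>t\<bar> / \<sigma> \<le> of_nat (m t)"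
      by (simp add: m_def real_nat_ceiling_ge)
    then show ?thesis
      using sigma by (simp add: field_simps)
  qed
  have iter: "(\<psi> \<sigma> q ^^ n) z = z" for n
    by (induction n) (simp_all add: fixed)
  have per: "\<psi> (t + of_nat n * \<sigma>) q z = \<psi> t q z" if "t \<ge> 0" for t n
    using periodic_cocycle_shift[OF cocycle sigma q that] by (simp add: iter)
  define u where "u t = \<psi> (t + of_nat (m t) * \<sigma>) q z" for t
  have u: "u t = \<psi> (t + of_nat n * \<sigma>) q z" if "t + of_nat n * \<sigma> \<ge> 0" for t n
  proof -
    have "t + of_nat (m t) * \<sigma> \<ge> 0"
      using m[of t] by linarith
    from per[OF this, of n] per[OF that, of "m t"] show ?thesis
      by (simp add: u_def add_ac)
  qed
  have "continuous (at t) u" for t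
  proof -
    \<comment> \<open>The extra period makes the shifted time strictly positive, so one
      \<open>n\<close> works on the open half-line \<open>?S\<close> around
      \<open>t\<close>.\<close>
    define n where "n = Suc (m t)"
    have n: "t + of_nat n * \<sigma> > 0"
      using m[of t] sigma by (simp add: n_def algebra_simps)
    let ?S = "{- (of_nat n * \<sigma>)<..}"
    have "continuous_on ?S (\<lambda>t. \<psi> (t + of_nat n * \<sigma>) q z)"
      by (rule continuous_on_compose2[OF cocycle_continuous_on_time[OF co q, of z]])
        (auto intro!: continuous_intros)
    then have "continuous_on ?S u"
      by (rule continuous_on_eq) (auto intro!: u[symmetric])
    then show ?thesis
      using n by (simp add: continuous_on_eq_continuous_at)
  qed
  then have "continuous_on UNIV u"
    by (simp add: continuous_on_eq_continuous_at)
  moreover have "u (t + s) = \<psi> t (rotation s q) (u s)" if "t \<ge> 0" for t s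
  proof -
    let ?s = "s + of_nat (m s) * \<sigma>"
    have s: "?s \<ge> 0"
      using m[of s] by linarith
    have "u (t + s) = \<psi> (t + ?s) q z"
      using u[of "t + s" "m s"] s that by (simp add: add_ac)
    also have "\<dots> = \<psi> t (rotation ?s q) (\<psi> ?s q z)"
      using co q s that by (simp add: cocycle_over_def)
    also have "rotation ?s q = rotation s q"
      using rotation_add rotation_period[OF q] by metis
    finally show ?thesis
      by (simp add: u_def)
  qed
  moreover have "u (t + \<sigma>) = u t" for t
  proof -
    have "t + of_nat (m t) * \<sigma> \<ge> 0"
      using m[of t] by linarith
    with u[of "t + \<sigma>" "m t"] u[of t "Suc (m t)"] sigma show ?thesis
      by (simp add: algebra_simps)
  qed
  moreover have "u 0 = z"
    using u[of 0 0] co q by (simp add: cocycle_over_def)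
  ultimately show thesis
    using that unfolding periodic_trajectory_def complete_trajectory_def by blast
qed

lemma periodic_trajectory_shift:
  assumes "periodic_trajectory \<sigma> \<theta> \<psi> q v"
  shows "v (t + of_nat n * \<sigma>) = v t"
proof (induction n)
  case (Suc n)
  have "v (t + of_nat (Suc n) * \<sigma>) = v ((t + of_nat n * \<sigma>) + \<sigma>)"
    by (simp add: algebra_simps)
  also have "\<dots> = v t"
    using assms Suc by (simp only: periodic_trajectory_def)
  finally show ?case .
qed simp

lemma periodic_trajectory_bounded:
  assumes "periodic_trajectory \<sigma> \<theta> \<psi> q v" "\<sigma> > 0"
  shows "bounded (v ` {0..})"
proof -
  have "v ` {0..} \<subseteq> v ` {0..\<sigma>}"
  proof safe
    fix t :: real assume "t \<ge> 0"
    define n where "n = nat \<lfloor>t / \<sigma>\<rfloor>"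
    have "of_nat n \<le> t / \<sigma>" "t / \<sigma> < of_nat n + 1"
      using \<open>t \<ge> 0\<close> \<open>\<sigma> > 0\<close> by (auto simp: n_def)
    then have "t - of_nat n * \<sigma> \<in> {0..\<sigma>}"
      using \<open>\<sigma> > 0\<close> by (simp add: field_simps)
    moreover have "v t = v (t - of_nat n * \<sigma>)"
      using periodic_trajectory_shift[OF assms(1), of "t - of_nat n * \<sigma>" n] by simp
    ultimately show "v t \<in> v ` {0..\<sigma>}"
      by blast
  qed
  moreover have "compact (v ` {0..\<sigma>})"
    using assms(1) unfolding periodic_trajectory_def complete_trajectory_def
    by (meson compact_Icc compact_continuous_image continuous_on_subset subset_UNIV)
  ultimately show ?thesis
    using compact_imp_bounded bounded_subset by blast
qed

section \<open>The splitting, and signs along paths\<close>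

lemma orthogonal_direct_sum_in_left:
  assumes "orthogonal_direct_sum E F" "\<And>y. y \<in> F \<Longrightarrow> orthogonal w y"
  shows "w \<in> E"
proof -
  obtain x y where xy: "x \<in> E" "y \<in> F" "w = x + y"
    using assms(1) unfolding orthogonal_direct_sum_def by blast
  have "orthogonal x y"
    using assms(1) xy by (auto simp: orthogonal_direct_sum_def)
  with assms(2)[of y] xy have "y = 0"
    by (auto simp: orthogonal_def inner_add_left)
  with xy show ?thesis by simp
qed

text \<open>Intermediate value theorem; it will show that a path inside the cone
  \<open>V < 0\<close> keeps the sign of its coordinate along the negative line.\<close>

lemma nonvanishing_path_same_sign:
  fixes f :: "real \<Rightarrow> real"
  assumes "a \<le> b" "continuous_on {a..b} f" "\<And>t. t \<in> {a..b} \<Longrightarrow> f t \<noteq> 0"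
  shows "f b * f a > 0"
proof (rule ccontr)
  assume "\<not> f b * f a > 0"
  then have "f b * f a \<le> 0" by simp
  then have "f a \<le> 0 \<and> 0 \<le> f b \<or> f b \<le> 0 \<and> 0 \<le> f a"
    unfolding mult_le_0_iff by blast
  then obtain t where "a \<le> t" "t \<le> b" "f t = 0"
    using IVT'[of f a 0 b] IVT2'[of f b 0 a] assms(1,2) by blast
  then show False
    using assms(3) by simp
qed

section \<open>Asymptotic stability of the isolated stable trajectory\<close>

theorem proposition5:
  fixes \<psi> :: "real \<Rightarrow> real set \<Rightarrow> 'h \<Rightarrow> 'h :: {real_inner, complete_space}"
    and P :: "'h \<Rightarrow> 'h"
    and Hp Hm :: "'h set"
    and \<sigma> \<delta> \<nu> :: real
  assumes separable: "separable_space (euclidean :: 'h topology)"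
    and sigma_pos: "\<sigma> > 0"
    and cocycle: "periodic_cocycle \<sigma> \<psi>"
    and P_bounded: "bounded_linear P"
    and P_selfadjoint: "\<And>x y. P x \<bullet> y = x \<bullet> P y"
    and splitting: "orthogonal_direct_sum Hp Hm"
    and invariant: "P ` Hp \<subseteq> Hp" "P ` Hm \<subseteq> Hm"
    and neg: "neg_definite_on P Hm"
    and pos: "pos_definite_on P Hp"
    and dim_Hm: "dim Hm = 1"
    and delta_pos: "\<delta> > 0"
    and nu_pos: "\<nu> > 0"
    and squeezing: "\<And>u v q l r. q \<in> circle \<sigma> \<Longrightarrow> 0 \<le> l \<Longrightarrow> l \<le> r \<Longrightarrow>
          exp (2 * \<nu> * r) * quad_form P (\<psi> r q u - \<psi> r q v)
            - exp (2 * \<nu> * l) * quad_form P (\<psi> l q u - \<psi> l q v)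
          \<le> - \<delta> * integral {l..r} (\<lambda>s. exp (2 * \<nu> * s) * (norm (\<psi> s q u - \<psi> s q v))\<^sup>2)"
    and compactness: "\<And>q u\<^sub>0. q \<in> circle \<sigma> \<Longrightarrow>
          bounded_semi_trajectory \<psi> q u\<^sub>0 \<Longrightarrow> compact_semi_trajectory \<psi> q u\<^sub>0"
  shows "\<forall>q \<in> circle \<sigma>. \<forall>v. periodic_trajectory \<sigma> rotation \<psi> q v \<longrightarrow>
           isolated_periodic_trajectory \<sigma> rotation \<psi> q v \<longrightarrow>
           lyapunov_stable \<psi> q v \<longrightarrow>
           asymptotically_lyapunov_stable \<psi> q v"
proof (intro ballI allI impI)
  fix q v
  assume q: "q \<in> circle \<sigma>" and per: "periodic_trajectory \<sigma> rotation \<psi> q v"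
    and iso: "isolated_periodic_trajectory \<sigma> rotation \<psi> q v" and stable: "lyapunov_stable \<psi> q v"
  define T where "T = \<psi> \<sigma> q"
  define V where "V = quad_form P"
  have co: "cocycle_over (circle \<sigma>) circle_dist rotation \<psi>"
    using cocycle by (simp add: periodic_cocycle_def)
  have psi0: "\<psi> 0 q u = u" for u
    using co q by (simp add: cocycle_over_def)
  have contT: "continuous_on UNIV T"
    using cocycle_continuous_on_space[OF co q] sigma_pos by (simp add: T_def)
  have contV: "continuous_on UNIV V"
    unfolding V_def quad_form_def
    by (intro continuous_intros bounded_linear.continuous_on[OF P_bounded])
  have contpsi: "continuous_on {0..r} (\<lambda>t. \<psi> t q u)" for u r
    by (rule continuous_on_subset[OF cocycle_continuous_on_time[OF co q]]) auto
  have cont: "continuous_on {0..r} (\<lambda>s. exp (2 * \<nu> * s) * (norm (\<psi> s q x - \<psi> s q y))\<^sup>2)" for x y r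
    by (intro continuous_intros contpsi)
  have integral_nonneg:
    "integral {0..r} (\<lambda>s. exp (2 * \<nu> * s) * (norm (\<psi> s q x - \<psi> s q y))\<^sup>2) \<ge> 0" for x y r
    using integrable_continuous_real[OF cont] by (intro integral_nonneg) auto
  \<comment> \<open>Squeezing from time 0, with the integral term dropped by its sign.\<close>
  have V_mono: "exp (2 * \<nu> * r) * V (\<psi> r q x - \<psi> r q y) \<le> V (x - y)" if "r \<ge> 0" for r x y
    using squeezing[OF q order_refl that, of x y] mult_nonneg_nonneg[OF _ integral_nonneg, of \<delta> r x y]
      delta_pos by (simp add: V_def psi0)
  define c where "c = exp (- (2 * \<nu> * \<sigma>))"
  have c: "0 < c" "c < 1"
    using nu_pos sigma_pos by (auto simp: c_def)
  have decay: "V (T x - T y) \<le> c * V (x - y)" for x y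
    using V_mono[of \<sigma> x y] sigma_pos by (simp add: T_def c_def exp_minus field_simps)
  \<comment> \<open>Both boundary terms of the squeezing inequality vanish, so the continuous
    nonnegative integrand is zero; its value at time 0 is the squared norm of
    \<open>x - y\<close>.\<close>
  have strict: "x = y" if "V (x - y) = 0" "V (T x - T y) = 0" for x y
  proof -
    let ?f = "\<lambda>s. exp (2 * \<nu> * s) * (norm (\<psi> s q x - \<psi> s q y))\<^sup>2"
    have "\<delta> * integral {0..\<sigma>} ?f \<le> 0"
      using squeezing[OF q order_refl, of \<sigma> x y] sigma_pos that by (simp add: V_def T_def psi0)
    then have "integral {0..\<sigma>} ?f = 0"
      using integral_nonneg[of \<sigma> x y] delta_pos by (simp add: mult_le_0_iff)
    then have "?f 0 = 0"
      using integral_eq_0_iff[OF cont sigma_pos, of x y] sigma_pos by auto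
    then show ?thesis
      by (simp add: psi0)
  qed
  \<comment> \<open>\<open>e\<close> spans the line \<open>Hm\<close>, so \<open>\<phi>\<close> is
    the coordinate along it up to a factor, and its kernel lies in \<open>Hp\<close>.\<close>
  obtain B where B: "B \<subseteq> Hm" "Hm \<subseteq> span B" "card B = 1"
    using basis_exists[of Hm] dim_Hm by metis
  then obtain e where e: "B = {e}"
    by (meson card_1_singletonE)
  define \<phi> where "\<phi> w = w \<bullet> e" for w
  have phi: "bounded_linear \<phi>"
    unfolding \<phi>_def by (rule bounded_linear_inner_left)
  have phi0: "V w \<ge> 0" if "\<phi> w = 0" for w
  proof -
    have "orthogonal w y" if "y \<in> Hm" for y
      using that B e \<open>\<phi> w = 0\<close> by (auto simp: \<phi>_def orthogonal_def span_singleton)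
    then have "w \<in> Hp"
      using orthogonal_direct_sum_in_left[OF splitting] by blast
    then show ?thesis
      using pos by (cases "w = 0") (auto simp: pos_definite_on_def V_def quad_form_def less_imp_le)
  qed
  \<comment> \<open>By \<open>V_mono\<close> the difference stays in the cone \<open>V < 0\<close>
    for the whole period, and by \<open>phi0\<close> its coordinate cannot vanish there.\<close>
  have sign: "\<phi> (T x - T y) * \<phi> (x - y) > 0" if "V (x - y) < 0" for x y
  proof -
    let ?f = "\<lambda>t. \<phi> (\<psi> t q x - \<psi> t q y)"
    have "?f t \<noteq> 0" if "t \<in> {0..\<sigma>}" for t
    proof -
      have "exp (2 * \<nu> * t) * V (\<psi> t q x - \<psi> t q y) < 0"
        using V_mono[of t x y] that \<open>V (x - y) < 0\<close> by simp
      then show ?thesis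
        using phi0[of "\<psi> t q x - \<psi> t q y"] by (auto simp: mult_less_0_iff)
    qed
    moreover have "continuous_on {0..\<sigma>} ?f"
      unfolding \<phi>_def by (intro continuous_intros contpsi)
    ultimately have "?f \<sigma> * ?f 0 > 0"
      using sigma_pos by (intro nonvanishing_path_same_sign) auto
    then show ?thesis
      by (simp add: T_def psi0)
  qed

  obtain \<epsilon>\<^sub>0 where eps0: "\<epsilon>\<^sub>0 > 0"
    and unique: "\<And>u. periodic_trajectory \<sigma> rotation \<psi> q u \<Longrightarrow> dist (u 0) (v 0) < \<epsilon>\<^sub>0 \<Longrightarrow> u = v"
  proof -
    obtain U where U: "open U" "v 0 \<in> U"
      "\<forall>u. periodic_trajectory \<sigma> rotation \<psi> q u \<and> u \<noteq> v \<longrightarrow> u 0 \<notin> U"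
      using iso unfolding isolated_periodic_trajectory_def by blast
    obtain r where "r > 0" "\<forall>y. dist y (v 0) < r \<longrightarrow> y \<in> U"
      using U(1,2) unfolding open_dist by blast
    with U(3) show thesis
      using that[of r] by blast
  qed
  have stay_near: "\<exists>\<eta>>0. \<forall>u. norm (u - v 0) < \<eta> \<longrightarrow> (\<forall>t\<ge>0. norm (\<psi> t q u - v t) < \<epsilon>)"
    if "\<epsilon> > 0" for \<epsilon>
    using stable that by (simp only: lyapunov_stable_def psi0)
  \<comment> \<open>Half the isolation radius: the orbit closure then fits in a closed ball strictly
    inside that radius.\<close>
  obtain \<eta>\<^sub>0 where eta0: "\<eta>\<^sub>0 > 0"
    and near: "\<And>u t. norm (u - v 0) < \<eta>\<^sub>0 \<Longrightarrow> t \<ge> 0 \<Longrightarrow> norm (\<psi> t q u - v t) < \<epsilon>\<^sub>0 / 2"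
    using stay_near[OF half_gt_zero[OF eps0]] by blast
  have "((\<lambda>t. \<psi> t q u - v t) \<longlongrightarrow> 0) at_top" if u: "norm (u - v 0) < \<eta>\<^sub>0" for u
  proof -
    let ?O = "range (\<lambda>n. (T ^^ n) u)"
    have iter: "(T ^^ n) u = \<psi> (of_nat n * \<sigma>) q u" for n
      using periodic_cocycle_iterate[OF cocycle sigma_pos q] by (simp add: T_def)
    have "?O \<subseteq> (\<lambda>t. \<psi> t q u) ` {0..}"
      using sigma_pos by (auto simp: iter)
    moreover have "bounded ((\<lambda>t. \<psi> t q u) ` {0..})"
    proof -
      obtain M where "\<And>t. t \<ge> 0 \<Longrightarrow> norm (v t) \<le> M"
        using periodic_trajectory_bounded[OF per sigma_pos] by (auto simp: bounded_iff)
      then have "norm (\<psi> t q u) \<le> M + \<epsilon>\<^sub>0 / 2" if "t \<ge> 0" for t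
        using near[OF u that] norm_triangle_sub[of "\<psi> t q u" "v t"] that by fastforce
      then show ?thesis
        by (auto simp: bounded_iff)
    qed
    then have "compact (closure ((\<lambda>t. \<psi> t q u) ` {0..}))"
      using compactness[OF q] by (simp add: bounded_semi_trajectory_def compact_semi_trajectory_def)
    ultimately have comp: "compact (closure ?O)"
      by (metis closed_closure closure_mono compact_Int_closed inf.absorb_iff2)
    \<comment> \<open>This fixed point starts a periodic trajectory within the isolation radius,
      which forces \<open>z = v 0\<close>.\<close>
    obtain z where z: "z \<in> closure ?O" "T z = z"
      using fixed_point_in_orbit_closure[where T = T and V = V and \<phi> = \<phi> and c = c and x = u,
          OF contT contV decay c strict phi phi0 sign comp] by blast
    have v_per: "v (t + of_nat n * \<sigma>) = v t" for t n
      by (rule periodic_trajectory_shift[OF per])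
    have "?O \<subseteq> cball (v 0) (\<epsilon>\<^sub>0 / 2)"
    proof -
      have "norm ((T ^^ n) u - v 0) < \<epsilon>\<^sub>0 / 2" for n
        using near[OF u, of "of_nat n * \<sigma>"] v_per[of 0 n] sigma_pos by (simp add: iter)
      then show ?thesis
        by (auto simp: dist_norm norm_minus_commute less_imp_le)
    qed
    then have "z \<in> cball (v 0) (\<epsilon>\<^sub>0 / 2)"
      using z closure_minimal closed_cball by blast
    then have "dist z (v 0) < \<epsilon>\<^sub>0"
      using eps0 by (simp add: dist_commute)
    moreover obtain w where "periodic_trajectory \<sigma> rotation \<psi> q w" "w 0 = z"
      using fixed_point_periodic_trajectory[OF cocycle sigma_pos q] z by (auto simp: T_def)
    ultimately have "z = v 0"
      using unique by blast
    show ?thesis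
    proof (rule tendstoI)
      fix \<epsilon> :: real assume "\<epsilon> > 0"
      then obtain \<eta> where "\<eta> > 0"
        and eta: "\<And>u t. norm (u - v 0) < \<eta> \<Longrightarrow> t \<ge> 0 \<Longrightarrow> norm (\<psi> t q u - v t) < \<epsilon>"
        using stay_near by blast
      \<comment> \<open>Some iterate enters the stability neighbourhood of \<open>v 0\<close>;
        restarting there after \<open>n\<close> periods, with \<open>q\<close> and \<open>v\<close>
        unchanged by the shift, controls all later times.\<close>
      obtain n where n: "norm ((T ^^ n) u - v 0) < \<eta>"
        using z(1) \<open>z = v 0\<close> \<open>\<eta> > 0\<close> by (auto simp: closure_approachable dist_norm)
      have "norm (\<psi> t q u - v t) < \<epsilon>" if "t \<ge> of_nat n * \<sigma>" for t
      proof -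
        have "t - of_nat n * \<sigma> \<ge> 0"
          using that by simp
        from eta[OF n this] periodic_cocycle_shift[OF cocycle sigma_pos q this, of n u]
          v_per[of "t - of_nat n * \<sigma>" n]
        show ?thesis by (simp add: T_def)
      qed
      then show "\<forall>\<^sub>F t in at_top. dist (\<psi> t q u - v t) 0 < \<epsilon>"
        unfolding eventually_at_top_linorder by auto
    qed
  qed
  then show "asymptotically_lyapunov_stable \<psi> q v"
    using stable eta0 by (auto simp: asymptotically_lyapunov_stable_def psi0)
qed

end
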